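(* For each positive integer $n$ there exists a complete metric space $X$ with the following properties: (1) $X$ admits a conical bicombing $\sigma$ and there is an $n$-point subset $A_0\subset X$ such that $X$ is the closed $\sigma$-convex hull of $A_0$; (2) whenever $A\subset Y$ is an $n$-point subset of a complete $\mathrm{CAT}(0)$ space $Y$, there exists a Lipschitz map $\Phi\colon X\to Y$ such that $\Phi(X)$ is convex and contains $A$.
   Context: Let $(X,d)$ be a metric space. A geodesic in $X$ is a map $c\colon[0,1]\to X$ with $d(c(s),c(t))=|s-t|\,d(c(0),c(1))$ for all $s,t\in[0,1]$. A (geodesic) bicombing on $X$ is a map $\sigma\colon X\times X\times[0,1]\to X$ such that for all $x,y\in X$ the path $\sigma_{xy}(t)=\sigma(x,y,t)$ is a geodesic with $\sigma_{xy}(0)=x$ and $\sigma_{xy}(1)=y$. It is called conical if $d(\sigma_{xy}(t),\sigma_{x'y'}(t))\le(1-t)\,d(x,x')+t\,d(y,y')$ for all $x,y,x',y'\in X$ and all $t\in[0,1]$. A subset $C\subset X$ is $\sigma$-convex if $\sigma_{xy}([0,1])\subset C$ for all $x,y\in C$. The closed $\sigma$-convex hull of $A\subset X$ is the intersection of all closed $\sigma$-convex subsets of $X$ containing $A$. A subset of a $\mathrm{CAT}(0)$ space is convex if it contains the (unique) geodesic between any two of its points. *)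

theory Defs
  imports "HOL-Analysis.Analysis"
begin

definition geodesic_path :: "'a metric \<Rightarrow> (real \<Rightarrow> 'a) \<Rightarrow> bool" where
  "geodesic_path X c \<longleftrightarrow> c \<in> {0..1} \<rightarrow> mspace X \<and>
     (\<forall>s\<in>{0..1}. \<forall>t\<in>{0..1}. mdist X (c s) (c t) = \<bar>s - t\<bar> * mdist X (c 0) (c 1))"

definition geodesic_from_to :: "'a metric \<Rightarrow> 'a \<Rightarrow> 'a \<Rightarrow> (real \<Rightarrow> 'a) \<Rightarrow> bool" where
  "geodesic_from_to X x y c \<longleftrightarrow> geodesic_path X c \<and> c 0 = x \<and> c 1 = y"

text \<open>A bicombing is curried: \<open>\<sigma> x y t\<close> stands for \<open>\<sigma>(x,y,t)\<close>. Its values outside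
  \<open>mspace X \<times> mspace X \<times> [0,1]\<close> are irrelevant.\<close>

definition bicombing :: "'a metric \<Rightarrow> ('a \<Rightarrow> 'a \<Rightarrow> real \<Rightarrow> 'a) \<Rightarrow> bool" where
  "bicombing X \<sigma> \<longleftrightarrow> (\<forall>x\<in>mspace X. \<forall>y\<in>mspace X. geodesic_from_to X x y (\<sigma> x y))"

definition conical_bicombing :: "'a metric \<Rightarrow> ('a \<Rightarrow> 'a \<Rightarrow> real \<Rightarrow> 'a) \<Rightarrow> bool" where
  "conical_bicombing X \<sigma> \<longleftrightarrow> bicombing X \<sigma> \<and>
     (\<forall>x\<in>mspace X. \<forall>y\<in>mspace X. \<forall>x'\<in>mspace X. \<forall>y'\<in>mspace X. \<forall>t\<in>{0..1}.
        mdist X (\<sigma> x y t) (\<sigma> x' y' t) \<le> (1 - t) * mdist X x x' + t * mdist X y y')"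

definition bicombing_convex ::
    "'a metric \<Rightarrow> ('a \<Rightarrow> 'a \<Rightarrow> real \<Rightarrow> 'a) \<Rightarrow> 'a set \<Rightarrow> bool" where
  "bicombing_convex X \<sigma> C \<longleftrightarrow> C \<subseteq> mspace X \<and> (\<forall>x\<in>C. \<forall>y\<in>C. \<sigma> x y ` {0..1} \<subseteq> C)"

definition closed_bicombing_hull ::
    "'a metric \<Rightarrow> ('a \<Rightarrow> 'a \<Rightarrow> real \<Rightarrow> 'a) \<Rightarrow> 'a set \<Rightarrow> 'a set" where
  "closed_bicombing_hull X \<sigma> A =
     \<Inter> {C. closedin (mtopology_of X) C \<and> bicombing_convex X \<sigma> C \<and> A \<subseteq> C}"

text \<open>CAT(0) in the sense of Euclidean comparison triangles. Any two different sides of a geodesic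
  triangle share a vertex, so it suffices to speak about pairs of sides issuing from a
  common vertex \<open>p\<close>, for all choices of \<open>p\<close>; the third side exists since the space is
  geodesic, and for two points on the same side the inequality is an equality.
  The point \<open>(1 - s) p' + s q'\<close> is the comparison point of \<open>c s\<close>.\<close>

definition CAT0_space :: "'a metric \<Rightarrow> bool" where
  "CAT0_space Y \<longleftrightarrow>
     (\<forall>x\<in>mspace Y. \<forall>y\<in>mspace Y. \<exists>c. geodesic_from_to Y x y c) \<and>
     (\<forall>p\<in>mspace Y. \<forall>q\<in>mspace Y. \<forall>r\<in>mspace Y. \<forall>c c'. \<forall>p' q' r' :: real^2.
        geodesic_from_to Y p q c \<and> geodesic_from_to Y p r c' \<and>
        dist p' q' = mdist Y p q \<and> dist p' r' = mdist Y p r \<and> dist q' r' = mdist Y q r \<longrightarrow>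
        (\<forall>s\<in>{0..1}. \<forall>t\<in>{0..1}.
           mdist Y (c s) (c' t)
             \<le> dist ((1 - s) *\<^sub>R p' + s *\<^sub>R q') ((1 - t) *\<^sub>R p' + t *\<^sub>R r')))"

definition geodesically_convex :: "'a metric \<Rightarrow> 'a set \<Rightarrow> bool" where
  "geodesically_convex Y C \<longleftrightarrow> C \<subseteq> mspace Y \<and>
     (\<forall>x\<in>C. \<forall>y\<in>C. \<forall>c. geodesic_from_to Y x y c \<longrightarrow> c ` {0..1} \<subseteq> C)"

definition hull_of_n_points :: "nat \<Rightarrow> 'a metric \<Rightarrow> bool" where
  "hull_of_n_points n X \<longleftrightarrow>
     (\<exists>\<sigma> A\<^sub>0. conical_bicombing X \<sigma> \<and> A\<^sub>0 \<subseteq> mspace X \<and> finite A\<^sub>0 \<and> card A\<^sub>0 = n \<and>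
        mspace X = closed_bicombing_hull X \<sigma> A\<^sub>0)"

text \<open>HOL cannot quantify over types inside a formula; the argument of type \<open>'b itself\<close> selects
  the type containing the carriers of the CAT(0) spaces \<open>Y\<close>.

  Pitfall: \<open>\<exists>X. dominates_n_point_sets n X TYPE('b)\<close> with a free \<open>'b\<close> would allow a different
  \<open>X\<close> for each \<open>'b\<close>. One \<open>X\<close> for all \<open>Y\<close> in all types is obtained from a pair of statements:
  some \<open>X\<close> satisfies a predicate not mentioning \<open>'b\<close> (here the instance \<open>'b = real\<close>), and every
  \<open>X\<close> satisfying this predicate satisfies \<open>dominates_n_point_sets n X TYPE('b)\<close>.
  Carriers in \<open>real\<close> are no restriction for \<open>X\<close>: a closed hull of finitely many points with
  respect to a conical bicombing is separable, hence has at most the cardinality of the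
  continuum.\<close>

definition dominates_n_point_sets :: "nat \<Rightarrow> 'a metric \<Rightarrow> 'b itself \<Rightarrow> bool" where
  "dominates_n_point_sets n X _ \<longleftrightarrow>
     (\<forall>(Y :: 'b metric) A.
        mcomplete_of Y \<and> CAT0_space Y \<and> A \<subseteq> mspace Y \<and> finite A \<and> card A = n \<longrightarrow>
        (\<exists>\<Phi>. Lipschitz_continuous_map X Y \<Phi> \<and>
              geodesically_convex Y (\<Phi> ` mspace X) \<and> A \<subseteq> \<Phi> ` mspace X))"

end

theory Submission
  imports Defs
begin

text \<open>Consider all complete metric spaces \<open>Y\<close> on sets of reals that carry a conical bicombing, together
  with \<open>n\<close> marked points, rescaled so that the marked points have mutual distance at most 1. Their
  product with the supremum metric is complete and has a conical bicombing acting coordinatewise. Let \<open>X\<close>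
  be the closed convex hull of the \<open>n\<close> points whose coordinates are the marked points. In a
  CAT(0) space geodesics are unique and form a conical bicombing, so every complete CAT(0) space on a
  set of reals is a coordinate of the product. The projection of \<open>X\<close> to this coordinate is Lipschitz
  and maps bicombing geodesics to geodesics, hence its image is convex.

  Both \<open>X\<close> and the closed convex hull of finitely many points in an arbitrary CAT(0) space are
  separable, so they have isometric copies on sets of reals. This places \<open>X\<close> in the type
  of reals, and reduces arbitrary \<open>Y\<close> to those on sets of reals.\<close>

section \<open>Closed hulls with respect to a conical bicombing\<close>

lemma closedin_mtopology_of_iff:
  "closedin (mtopology_of M) C \<longleftrightarrow>
     C \<subseteq> mspace M \<and> (\<forall>x\<in>mspace M. (\<forall>e>0. \<exists>y\<in>C. mdist M x y < e) \<longrightarrow> x \<in> C)"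
proof -
  interpret Metric_space "mspace M" "mdist M" ..
  show ?thesis
    unfolding mtopology_of_def closedin_metric disjnt_iff in_mball by (metis DiffD1 DiffD2 DiffI subsetD)
qed

lemma in_closure_mtopology_of_iff:
  assumes "S \<subseteq> mspace M"
  shows "x \<in> mtopology_of M closure_of S \<longleftrightarrow> x \<in> mspace M \<and> (\<forall>e>0. \<exists>y\<in>S. mdist M x y < e)"
proof -
  interpret Metric_space "mspace M" "mdist M" ..
  show ?thesis
    using assms by (auto simp: mtopology_of_def metric_closure_of subset_iff)
qed

lemma mcomplete_of_iff:
  "mcomplete_of M \<longleftrightarrow>
     (\<forall>s. range s \<subseteq> mspace M \<and> (\<forall>e>0. \<exists>N::nat. \<forall>m n. N \<le> m \<longrightarrow> N \<le> n \<longrightarrow> mdist M (s m) (s n) < e) \<longrightarrow>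
        (\<exists>l\<in>mspace M. \<forall>e>0. \<exists>N. \<forall>n\<ge>N. mdist M (s n) l < e))"
proof -
  interpret Metric_space "mspace M" "mdist M" ..
  have "limitin mtopology s l sequentially \<longleftrightarrow>
      l \<in> mspace M \<and> (\<forall>e>0. \<exists>N. \<forall>n\<ge>N. mdist M (s n) l < e)" if "MCauchy s" for s l
  proof -
    have "s n \<in> mspace M" for n using that by (auto simp: MCauchy_def)
    then show ?thesis by (simp add: limit_metric_sequentially)
  qed
  then have "mcomplete_of M \<longleftrightarrow>
      (\<forall>s. MCauchy s \<longrightarrow> (\<exists>l\<in>mspace M. \<forall>e>0. \<exists>N. \<forall>n\<ge>N. mdist M (s n) l < e))"
    unfolding mcomplete_of_def mcomplete_def by blast
  then show ?thesis unfolding MCauchy_def .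
qed

section \<open>Elementary consequences of the conical bicombing axioms\<close>

context
  fixes M :: "'a metric" and \<sigma> :: "'a \<Rightarrow> 'a \<Rightarrow> real \<Rightarrow> 'a"
  assumes conical: "conical_bicombing M \<sigma>"
begin

lemma conical_bicombing_geodesic:
  "x \<in> mspace M \<Longrightarrow> y \<in> mspace M \<Longrightarrow> geodesic_from_to M x y (\<sigma> x y)"
  using conical by (auto simp: conical_bicombing_def bicombing_def)

lemma conical_bicombing_mem:
  "x \<in> mspace M \<Longrightarrow> y \<in> mspace M \<Longrightarrow> 0 \<le> t \<Longrightarrow> t \<le> 1 \<Longrightarrow> \<sigma> x y t \<in> mspace M"
  using conical_bicombing_geodesic by (auto simp: geodesic_from_to_def geodesic_path_def Pi_iff)

lemma conical_bicombing_ends: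
  "x \<in> mspace M \<Longrightarrow> y \<in> mspace M \<Longrightarrow> \<sigma> x y 0 = x"
  "x \<in> mspace M \<Longrightarrow> y \<in> mspace M \<Longrightarrow> \<sigma> x y 1 = y"
  using conical_bicombing_geodesic by (auto simp: geodesic_from_to_def)

lemma conical_bicombing_dist:
  assumes "x \<in> mspace M" "y \<in> mspace M" "s \<in> {0..1}" "t \<in> {0..1}"
  shows "mdist M (\<sigma> x y s) (\<sigma> x y t) = \<bar>s - t\<bar> * mdist M x y"
  using conical_bicombing_geodesic[OF assms(1,2)] assms(3,4)
  unfolding geodesic_from_to_def geodesic_path_def by metis

lemma conical_bicombing_le:
  assumes "x \<in> mspace M" "y \<in> mspace M" "x' \<in> mspace M" "y' \<in> mspace M" "t \<in> {0..1}"
  shows "mdist M (\<sigma> x y t) (\<sigma> x' y' t) \<le> (1 - t) * mdist M x x' + t * mdist M y y'"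
  using conical assms by (auto simp: conical_bicombing_def)

end

text \<open>Upper bounds suffice: the bounds for the pieces over [0,s], [s,t] and [t,1] add up to
  the distance of \<open>x\<close> and \<open>y\<close>, so the triangle inequality forces equality
  in each of them.\<close>

lemma geodesic_from_toI:
  assumes mem: "\<And>t. t \<in> {0..1} \<Longrightarrow> c t \<in> mspace M" and ends: "c 0 = x" "c 1 = y"
    and le: "\<And>s t. \<lbrakk>0 \<le> s; s \<le> t; t \<le> 1\<rbrakk> \<Longrightarrow> mdist M (c s) (c t) \<le> (t - s) * mdist M x y"
  shows "geodesic_from_to M x y c"
proof -
  have eq: "mdist M (c s) (c t) = (t - s) * mdist M x y" if "0 \<le> s" "s \<le> t" "t \<le> 1" for s t
  proof -
    have m: "x \<in> mspace M" "c s \<in> mspace M" "c t \<in> mspace M" "y \<in> mspace M"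
      using mem[of 0] mem[of 1] mem[of s] mem[of t] ends that by auto
    have "mdist M x y \<le> mdist M x (c s) + mdist M (c s) (c t) + mdist M (c t) y"
      using mdist_triangle m by (smt (verit, best))
    moreover have "mdist M x (c s) \<le> s * mdist M x y"
      using le[of 0 s] that ends by simp
    moreover have "mdist M (c t) y \<le> (1 - t) * mdist M x y"
      using le[of t 1] that ends by simp
    ultimately show ?thesis
      using le[OF that] by (simp add: algebra_simps)
  qed
  have "mdist M (c s) (c t) = \<bar>s - t\<bar> * mdist M x y" if "s \<in> {0..1}" "t \<in> {0..1}" for s t
    using eq[of s t] eq[of t s] that by (cases "s \<le> t") (auto simp: mdist_commute)
  then show ?thesis
    using mem ends by (auto simp: geodesic_from_to_def geodesic_path_def)
qed

section \<open>The countable rational hull and its closure\<close>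

text \<open>Restricting to rational parameters keeps the hull countable; its closure is still convex
  because the bicombing is jointly continuous.\<close>

inductive_set rational_hull :: "('a \<Rightarrow> 'a \<Rightarrow> real \<Rightarrow> 'a) \<Rightarrow> 'a set \<Rightarrow> 'a set"
  for \<sigma> :: "'a \<Rightarrow> 'a \<Rightarrow> real \<Rightarrow> 'a" and A :: "'a set" where
  base: "a \<in> A \<Longrightarrow> a \<in> rational_hull \<sigma> A"
| step: "\<lbrakk>x \<in> rational_hull \<sigma> A; y \<in> rational_hull \<sigma> A; q \<in> \<rat>; 0 \<le> q; q \<le> 1\<rbrakk> \<Longrightarrow> \<sigma> x y q \<in> rational_hull \<sigma> A"

lemma countable_rational_hull:
  assumes "countable A"
  shows "countable (rational_hull \<sigma> A)"
proof -
  define H where "H = rec_nat A (\<lambda>_ B. B \<union> (\<lambda>(x, y, q). \<sigma> x y q) ` (B \<times> B \<times> \<rat>))"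
  have H_0: "H 0 = A" and H_Suc: "H (Suc k) = H k \<union> (\<lambda>(x, y, q). \<sigma> x y q) ` (H k \<times> H k \<times> \<rat>)" for k
    by (simp_all add: H_def)
  have "countable (H k)" for k
    by (induction k) (auto simp: H_0 H_Suc assms countable_rat)
  moreover have "rational_hull \<sigma> A \<subseteq> (\<Union>k. H k)"
  proof
    fix x assume "x \<in> rational_hull \<sigma> A"
    then have "\<exists>k. x \<in> H k"
    proof induction
      case (base a)
      then show ?case using H_0 by blast
    next
      case (step x y q)
      then obtain j k where "x \<in> H j" "y \<in> H k" by blast
      \<comment> \<open>Points that appear at different stages are compared at a common later
        stage.\<close>
      moreover have "mono H" by (rule incseq_SucI) (auto simp: H_Suc)
      ultimately have "x \<in> H (max j k)" "y \<in> H (max j k)"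
        using monoD[of H j "max j k"] monoD[of H k "max j k"] by auto
      then have "\<sigma> x y q \<in> H (Suc (max j k))"
        using \<open>q \<in> \<rat>\<close> by (force simp: H_Suc)
      then show ?case ..
    qed
    then show "x \<in> (\<Union>k. H k)" by blast
  qed
  ultimately show ?thesis
    by (auto intro: countable_subset)
qed

lemma rational_hull_subset:
  assumes "bicombing_convex M \<sigma> C" "A \<subseteq> C"
  shows "rational_hull \<sigma> A \<subseteq> C"
proof
  fix x assume "x \<in> rational_hull \<sigma> A"
  then show "x \<in> C"
    by induction (use assms in \<open>auto simp: bicombing_convex_def image_subset_iff\<close>)
qed

lemma bicombing_convex_mspace:
  assumes "conical_bicombing M \<sigma>"
  shows "bicombing_convex M \<sigma> (mspace M)"
  using conical_bicombing_mem[OF assms] by (auto simp: bicombing_convex_def)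

lemma rational_hull_subset_mspace:
  assumes "conical_bicombing M \<sigma>" "A \<subseteq> mspace M"
  shows "rational_hull \<sigma> A \<subseteq> mspace M"
  by (rule rational_hull_subset[OF bicombing_convex_mspace[OF assms(1)] assms(2)])

text \<open>The end points are approximated by points of the hull and the parameter by a rational
  one. Changing the parameter costs \<bar>t - q\<bar> times the distance of the end points; changing
  the end points is controlled by the conical inequality.\<close>

lemma bicombing_convex_closure_rational_hull:
  assumes conical: "conical_bicombing M \<sigma>" and A: "A \<subseteq> mspace M"
  shows "bicombing_convex M \<sigma> (mtopology_of M closure_of rational_hull \<sigma> A)"
proof -
  let ?D = "rational_hull \<sigma> A" and ?H = "mtopology_of M closure_of rational_hull \<sigma> A"
  have D: "?D \<subseteq> mspace M"
    by (rule rational_hull_subset_mspace[OF conical A])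
  note H_iff = in_closure_mtopology_of_iff[OF D]
  have "\<sigma> x y t \<in> ?H" if x: "x \<in> ?H" and y: "y \<in> ?H" and t: "t \<in> {0..1}" for x y t
  proof -
    have xy: "x \<in> mspace M" "y \<in> mspace M" using x y H_iff by auto
    have "\<exists>z\<in>?D. mdist M (\<sigma> x y t) z < e" if "e > 0" for e
    proof -
      define b where "b = mdist M x y"
      have "b \<ge> 0" by (simp add: b_def)
      \<comment> \<open>The denominator \<open>1 + b\<close> instead of \<open>b\<close> covers the
        case x = y.\<close>
      define \<delta> where "\<delta> = e / 2 / (1 + b)"
      have "\<delta> > 0"
        unfolding \<delta>_def using that \<open>b \<ge> 0\<close> by (intro divide_pos_pos) auto
      have "\<delta> * (1 + b) = e / 2"
        unfolding \<delta>_def using \<open>b \<ge> 0\<close> by (intro nonzero_eq_divide_eq[THEN iffD1]) auto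
      then have \<delta>: "\<delta> * b < e / 2"
        using \<open>\<delta> > 0\<close> by (simp add: distrib_left)
      have "\<exists>q\<in>\<rat>. 0 \<le> q \<and> q \<le> 1 \<and> \<bar>t - q\<bar> < \<delta>"
      \<comment> \<open>The rational is taken slightly below \<open>t\<close>, which leaves no room
        in [0,1] when t = 0.\<close>
      proof (cases "t = 0")
        case True
        then show ?thesis using \<open>\<delta> > 0\<close> by (intro bexI[of _ 0]) auto
      next
        case False
        then have "max 0 (t - \<delta>) < t" using t \<open>\<delta> > 0\<close> by auto
        from Rats_dense_in_real[OF this] obtain q where "q \<in> \<rat>" "max 0 (t - \<delta>) < q" "q < t" by blast
        moreover from this have "0 \<le> q" "q \<le> 1" "\<bar>t - q\<bar> < \<delta>" using t by auto
        ultimately show ?thesis by blast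
      qed
      then obtain q where q: "q \<in> \<rat>" "0 \<le> q" "q \<le> 1" "\<bar>t - q\<bar> < \<delta>" by blast
      obtain x' where x': "x' \<in> ?D" "mdist M x x' < e / 2"
        using x half_gt_zero[OF \<open>e > 0\<close>] unfolding H_iff by blast
      obtain y' where y': "y' \<in> ?D" "mdist M y y' < e / 2"
        using y half_gt_zero[OF \<open>e > 0\<close>] unfolding H_iff by blast
      have m: "x' \<in> mspace M" "y' \<in> mspace M" using D x' y' by auto
      have "\<sigma> x y t \<in> mspace M" "\<sigma> x y q \<in> mspace M" "\<sigma> x' y' q \<in> mspace M"
        using conical_bicombing_mem[OF conical] xy m q t by simp_all
      then have "mdist M (\<sigma> x y t) (\<sigma> x' y' q) \<le>
          mdist M (\<sigma> x y t) (\<sigma> x y q) + mdist M (\<sigma> x y q) (\<sigma> x' y' q)"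
        by (rule mdist_triangle)
      also have "mdist M (\<sigma> x y t) (\<sigma> x y q) \<le> \<delta> * b"
        using conical_bicombing_dist[OF conical xy, of t q] t q mult_right_mono[of "\<bar>t - q\<bar>" \<delta> b] \<open>b \<ge> 0\<close>
        by (simp add: b_def)
      also have "mdist M (\<sigma> x y q) (\<sigma> x' y' q) \<le> (1 - q) * mdist M x x' + q * mdist M y y'"
        using conical_bicombing_le[OF conical xy m] q by auto
      also have "\<dots> \<le> (1 - q) * (e / 2) + q * (e / 2)"
        using q x' y' by (intro add_mono mult_left_mono) auto
      also have "\<delta> * b + ((1 - q) * (e / 2) + q * (e / 2)) < e"
        proof -
        have "(1 - q) * c + q * c = c" for c :: real by (simp add: left_diff_distrib)
        then show ?thesis using \<delta> by (metis add_strict_right_mono field_sum_of_halves)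
      qed
      finally have "mdist M (\<sigma> x y t) (\<sigma> x' y' q) < e"
        by simp
      then show ?thesis
        using rational_hull.step[OF x'(1) y'(1) q(1-3)] by blast
    qed
    moreover have "\<sigma> x y t \<in> mspace M"
      using conical_bicombing_mem[OF conical xy] t by simp
    ultimately show ?thesis
      unfolding H_iff by blast
  qed
  moreover have "?H \<subseteq> mspace M"
    using H_iff by blast
  ultimately show ?thesis
    unfolding bicombing_convex_def by blast
qed

lemma closure_rational_hull_superset:
  assumes con: "conical_bicombing M \<sigma>" and A: "A \<subseteq> mspace M"
  shows "A \<subseteq> mtopology_of M closure_of rational_hull \<sigma> A"
proof -
  have "rational_hull \<sigma> A \<subseteq> mspace M"
    by (rule rational_hull_subset_mspace[OF con A])
  then have "rational_hull \<sigma> A \<subseteq> mtopology_of M closure_of rational_hull \<sigma> A"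
    by (simp add: closure_of_subset)
  then show ?thesis
    by (auto intro: rational_hull.base)
qed

section \<open>Cardinality of the closure of a countable set\<close>

text \<open>A point of the closure is determined by the balls of radius \<open>1 / (m + 1)\<close> around points of
  \<open>D\<close> that contain it, that is, by a subset of a countable set.\<close>

lemma separable_inj_real:
  fixes M :: "'a metric"
  assumes D: "countable D" "D \<subseteq> mspace M"
  shows "\<exists>f :: 'a \<Rightarrow> real. inj_on f (mtopology_of M closure_of D)"
proof -
  \<comment> \<open>Subsets of the countable set of pairs (centre, radius index) become sets of
    naturals via \<open>k\<close> and then reals via \<open>j\<close>.\<close>
  obtain j :: "nat set \<Rightarrow> real" where "inj j"
    using eqpoll_imp_lepoll[OF nat_sets_eqpoll_reals] by (auto simp: lepoll_def)
  have "countable (D \<times> (UNIV :: nat set))"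
    using D(1) by auto
  then obtain k :: "'a \<times> nat \<Rightarrow> nat" where k: "inj_on k (D \<times> UNIV)"
    by (rule countableE)
  define P where "P x = {(d, m). d \<in> D \<and> mdist M x d < 1 / Suc m}" for x
  have P_inj: "x = y" if x: "x \<in> mtopology_of M closure_of D"
    and y: "y \<in> mtopology_of M closure_of D" and "P x = P y" for x y
  proof (rule ccontr)
    assume "x \<noteq> y"
    have m: "x \<in> mspace M" "y \<in> mspace M"
      using x y in_closure_mtopology_of_iff[OF D(2)] by auto
    then have "mdist M x y / 2 > 0"
      using \<open>x \<noteq> y\<close> mdist_zero[OF m] mdist_nonneg[of M x y] by linarith
    \<comment> \<open>With this radius no ball can contain both \<open>x\<close> and
      \<open>y\<close>.\<close>
    then obtain m where "1 / Suc m < mdist M x y / 2"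
      using nat_approx_posE by metis
    have "0 < 1 / real (Suc m)" by simp
    then obtain d where d: "d \<in> D" "mdist M x d < 1 / Suc m"
      using x unfolding in_closure_mtopology_of_iff[OF D(2)] by blast
    then have "(d, m) \<in> P y" unfolding \<open>P x = P y\<close>[symmetric] by (simp add: P_def)
    then have "mdist M d y < 1 / Suc m" by (simp add: P_def mdist_commute)
    then show False
      using mdist_triangle[OF m(1) subsetD[OF D(2) d(1)] m(2)] d(2) \<open>1 / Suc m < mdist M x y / 2\<close>
      by linarith
  qed
  have P_sub: "P x \<subseteq> D \<times> UNIV" for x by (auto simp: P_def)
  have "inj_on (\<lambda>x. j (k ` P x)) (mtopology_of M closure_of D)"
  proof (rule inj_onI)
    fix x y
    assume x: "x \<in> mtopology_of M closure_of D" and y: "y \<in> mtopology_of M closure_of D"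
      and "j (k ` P x) = j (k ` P y)"
    then have "k ` P x = k ` P y" by (meson injD[OF \<open>inj j\<close>])
    then have "P x = P y" using inj_on_image_eq_iff[OF k P_sub P_sub] by blast
    then show "x = y" by (rule P_inj[OF x y])
  qed
  then show ?thesis by blast
qed

section \<open>Isometric copies of subspaces\<close>

text \<open>The map runs from the copy \<open>N\<close> into the original space \<open>M\<close>.
  Its injectivity is not demanded, as it follows from preservation of distances.\<close>

definition isometry_onto :: "'b metric \<Rightarrow> 'a metric \<Rightarrow> ('b \<Rightarrow> 'a) \<Rightarrow> 'a set \<Rightarrow> bool" where
  "isometry_onto N M g H \<longleftrightarrow> g ` mspace N = H \<and> H \<subseteq> mspace M \<and>
     (\<forall>x\<in>mspace N. \<forall>y\<in>mspace N. mdist N x y = mdist M (g x) (g y))"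

text \<open>The metric of \<open>M\<close> is pulled back to the image of \<open>f\<close>. Since
  \<open>f\<close> merely renames points, injectivity is enough and no continuity enters.\<close>

lemma isometry_onto_exists:
  assumes "inj_on f H" "H \<subseteq> mspace M"
  shows "\<exists>N. isometry_onto N M (inv_into H f) H"
proof -
  let ?g = "inv_into H f" and ?N = "f ` H"
  have g: "?g x \<in> mspace M" if "x \<in> ?N" for x
    using that assms by (auto simp: inv_into_into subset_iff)
  have "Metric_space ?N (\<lambda>x y. mdist M (?g x) (?g y))"
  proof
    fix x y z
    show "0 \<le> mdist M (?g x) (?g y)" by simp
    show "mdist M (?g x) (?g y) = mdist M (?g y) (?g x)" by (rule mdist_commute)
    show "mdist M (?g x) (?g y) = 0 \<longleftrightarrow> x = y" if "x \<in> ?N" "y \<in> ?N"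
      using that g by (simp add: inv_into_injective inj_on_eq_iff[OF inj_on_inv_into[of ?N f H]])
    show "mdist M (?g x) (?g z) \<le> mdist M (?g x) (?g y) + mdist M (?g y) (?g z)"
      if "x \<in> ?N" "y \<in> ?N" "z \<in> ?N"
      using that g by (intro mdist_triangle) auto
  qed
  then have "isometry_onto (metric (?N, \<lambda>x y. mdist M (?g x) (?g y))) M ?g H"
    using assms
    by (simp add: isometry_onto_def Metric_space.mspace_metric Metric_space.mdist_metric inj_on_imp_bij_betw
        bij_betw_imp_surj_on[OF bij_betw_inv_into])
  then show ?thesis ..
qed

section \<open>Transport of completeness, geodesics, bicombings and the CAT(0) inequality to a
  copy\<close>

context
  fixes N :: "'b metric" and M :: "'a metric" and g H
  assumes iso: "isometry_onto N M g H"
begin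

lemma isometry_onto_mem: "x \<in> mspace N \<Longrightarrow> g x \<in> H" "x \<in> mspace N \<Longrightarrow> g x \<in> mspace M"
  using iso by (auto simp: isometry_onto_def)

lemma isometry_onto_dist: "x \<in> mspace N \<Longrightarrow> y \<in> mspace N \<Longrightarrow> mdist N x y = mdist M (g x) (g y)"
  using iso by (auto simp: isometry_onto_def)

lemma isometry_onto_inj: "inj_on g (mspace N)"
proof (rule inj_onI)
  fix x y assume "x \<in> mspace N" "y \<in> mspace N" "g x = g y"
  then have "mdist N x y = 0"
    using isometry_onto_mem(2) by (simp add: isometry_onto_dist)
  then show "x = y"
    using \<open>x \<in> mspace N\<close> \<open>y \<in> mspace N\<close> by simp
qed

lemma isometry_onto_inv:
  assumes "z \<in> H"
  shows "inv_into (mspace N) g z \<in> mspace N" "g (inv_into (mspace N) g z) = z"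
  using assms iso by (auto simp: isometry_onto_def inv_into_into f_inv_into_f)

text \<open>A Cauchy sequence of the copy converges in \<open>M\<close>, and closedness puts its
  limit into \<open>H\<close>, where it can be pulled back.\<close>

lemma isometry_onto_mcomplete:
  assumes "mcomplete_of M" "closedin (mtopology_of M) H"
  shows "mcomplete_of N"
  unfolding mcomplete_of_iff
proof (intro allI impI, elim conjE)
  fix s assume s: "range s \<subseteq> mspace N"
    and cauchy: "\<forall>e>0. \<exists>K::nat. \<forall>m n. K \<le> m \<longrightarrow> K \<le> n \<longrightarrow> mdist N (s m) (s n) < e"
  have sN: "s n \<in> mspace N" for n using s by auto
  have "\<forall>e>0. \<exists>K::nat. \<forall>m n. K \<le> m \<longrightarrow> K \<le> n \<longrightarrow> mdist M (g (s m)) (g (s n)) < e"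
    using cauchy by (simp add: isometry_onto_dist sN)
  moreover have "range (\<lambda>n. g (s n)) \<subseteq> mspace M"
    using isometry_onto_mem(2) sN by blast
  ultimately obtain l where l: "l \<in> mspace M" "\<forall>e>0. \<exists>K. \<forall>n\<ge>K. mdist M (g (s n)) l < e"
    using assms(1)[unfolded mcomplete_of_iff, rule_format, of "\<lambda>n. g (s n)"] by blast
  have "\<exists>y\<in>H. mdist M l y < e" if e: "e > 0" for e
  proof -
    obtain n where "mdist M (g (s n)) l < e" using l(2) e by blast
    then show ?thesis using isometry_onto_mem(1)[OF sN] by (auto simp: mdist_commute)
  qed
  then have "l \<in> H"
    using assms(2) l(1) unfolding closedin_mtopology_of_iff by blast
  note h = isometry_onto_inv[OF this]
  have "\<forall>e>0. \<exists>K. \<forall>n\<ge>K. mdist N (s n) (inv_into (mspace N) g l) < e"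
    using l(2) h by (simp add: isometry_onto_dist sN)
  then show "\<exists>l\<in>mspace N. \<forall>e>0. \<exists>K. \<forall>n\<ge>K. mdist N (s n) l < e"
    using h(1) by blast
qed

lemma isometry_onto_geodesic:
  assumes c: "geodesic_from_to N x y c" and "x \<in> mspace N" "y \<in> mspace N"
  shows "geodesic_from_to M (g x) (g y) (\<lambda>t. g (c t))"
proof -
  have mem: "c t \<in> mspace N" if "t \<in> {0..1}" for t
    using c that by (auto simp: geodesic_from_to_def geodesic_path_def)
  have "mdist M (g (c s)) (g (c t)) = \<bar>s - t\<bar> * mdist M (g x) (g y)"
    if "s \<in> {0..1}" "t \<in> {0..1}" for s t
  proof -
    have "mdist N (c s) (c t) = \<bar>s - t\<bar> * mdist N x y"
      using c that unfolding geodesic_from_to_def geodesic_path_def by blast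
    then show ?thesis
      using assms mem that by (simp add: isometry_onto_dist)
  qed
  then show ?thesis
    using c mem isometry_onto_mem(2) by (auto simp: geodesic_from_to_def geodesic_path_def)
qed

lemma isometry_onto_geodesic_inv:
  assumes c: "geodesic_from_to M (g x) (g y) c" and xy: "x \<in> mspace N" "y \<in> mspace N"
    and H: "c ` {0..1} \<subseteq> H"
  shows "geodesic_from_to N x y (\<lambda>t. inv_into (mspace N) g (c t))"
proof (rule geodesic_from_toI)
  have mem: "c t \<in> H" if "t \<in> {0..1}" for t using that H by auto
  then show "inv_into (mspace N) g (c t) \<in> mspace N" if "t \<in> {0..1}" for t
    using that isometry_onto_inv by blast
  show "inv_into (mspace N) g (c 0) = x" "inv_into (mspace N) g (c 1) = y"
    using c xy isometry_onto_inj by (auto simp: geodesic_from_to_def)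
  show "mdist N (inv_into (mspace N) g (c s)) (inv_into (mspace N) g (c t)) \<le> (t - s) * mdist N x y"
    if "0 \<le> s" "s \<le> t" "t \<le> 1" for s t
  proof -
    have "mdist M (c s) (c t) = \<bar>s - t\<bar> * mdist M (g x) (g y)"
      using c that unfolding geodesic_from_to_def geodesic_path_def by auto
    then show ?thesis
      using that isometry_onto_inv[OF mem] xy by (simp add: isometry_onto_dist)
  qed
qed

text \<open>Convexity of \<open>H\<close> keeps the bicombing lines inside the range of
  \<open>g\<close>, so they can be pulled back; the conical inequality is then inherited.\<close>

lemma isometry_onto_conical_bicombing:
  assumes con: "conical_bicombing M \<sigma>" and conv: "bicombing_convex M \<sigma> H"
  shows "conical_bicombing N (\<lambda>x y t. inv_into (mspace N) g (\<sigma> (g x) (g y) t))"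
  unfolding conical_bicombing_def bicombing_def
proof (intro conjI ballI)
  have H: "\<sigma> (g x) (g y) ` {0..1} \<subseteq> H" if "x \<in> mspace N" "y \<in> mspace N" for x y
    using conv isometry_onto_mem(1) that unfolding bicombing_convex_def by blast
  show "geodesic_from_to N x y (\<lambda>t. inv_into (mspace N) g (\<sigma> (g x) (g y) t))"
    if "x \<in> mspace N" "y \<in> mspace N" for x y
    using that conical_bicombing_geodesic[OF con] isometry_onto_mem(2) H
    by (intro isometry_onto_geodesic_inv) auto
  fix x y x' y' and t :: real
  assume m: "x \<in> mspace N" "y \<in> mspace N" "x' \<in> mspace N" "y' \<in> mspace N" and t: "t \<in> {0..1}"
  have "\<sigma> (g x) (g y) t \<in> H" "\<sigma> (g x') (g y') t \<in> H"
    using H m t by blast+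
  then show "mdist N (inv_into (mspace N) g (\<sigma> (g x) (g y) t)) (inv_into (mspace N) g (\<sigma> (g x') (g y') t))
      \<le> (1 - t) * mdist N x x' + t * mdist N y y'"
    using conical_bicombing_le[OF con, of "g x" "g y" "g x'" "g y'" t] m t isometry_onto_mem(2)
    by (simp add: isometry_onto_dist isometry_onto_inv)
qed

text \<open>Convexity of \<open>H\<close> supplies geodesics in the copy. Conversely, geodesics of
  the copy are geodesics of \<open>M\<close> with the same comparison triangles, so the inequality
  restricts.\<close>

lemma isometry_onto_CAT0:
  assumes cat: "CAT0_space M" and conv: "geodesically_convex M H"
  shows "CAT0_space N"
  unfolding CAT0_space_def
proof (intro conjI ballI allI impI)
  fix x y assume xy: "x \<in> mspace N" "y \<in> mspace N"
  then obtain c where c: "geodesic_from_to M (g x) (g y) c"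
    using cat isometry_onto_mem(2) unfolding CAT0_space_def by meson
  then have "c ` {0..1} \<subseteq> H"
    using conv isometry_onto_mem(1) xy unfolding geodesically_convex_def by meson
  then show "\<exists>c. geodesic_from_to N x y c"
    using isometry_onto_geodesic_inv[OF c xy] by blast
next
  fix p q r c c' and s t :: real and p' q' r' :: "real^2"
  assume m: "p \<in> mspace N" "q \<in> mspace N" "r \<in> mspace N" and st: "s \<in> {0..1}" "t \<in> {0..1}"
  assume *: "geodesic_from_to N p q c \<and> geodesic_from_to N p r c' \<and>
    dist p' q' = mdist N p q \<and> dist p' r' = mdist N p r \<and> dist q' r' = mdist N q r"
  then have c: "geodesic_from_to N p q c" "geodesic_from_to N p r c'"
    by blast+
  then have "c s \<in> mspace N" "c' t \<in> mspace N"
    using st by (auto simp: geodesic_from_to_def geodesic_path_def)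
  moreover have "mdist M (g (c s)) (g (c' t)) \<le>
      dist ((1 - s) *\<^sub>R p' + s *\<^sub>R q') ((1 - t) *\<^sub>R p' + t *\<^sub>R r')"
  proof (rule cat[unfolded CAT0_space_def, THEN conjunct2, rule_format])
    show "g p \<in> mspace M" "g q \<in> mspace M" "g r \<in> mspace M"
      using m isometry_onto_mem(2) by auto
    show "geodesic_from_to M (g p) (g q) (\<lambda>t. g (c t)) \<and> geodesic_from_to M (g p) (g r) (\<lambda>t. g (c' t)) \<and>
      dist p' q' = mdist M (g p) (g q) \<and> dist p' r' = mdist M (g p) (g r) \<and> dist q' r' = mdist M (g q) (g r)"
      using * isometry_onto_geodesic[OF c(1) m(1,2)] isometry_onto_geodesic[OF c(2) m(1,3)]
        isometry_onto_dist[OF m(1,2)] isometry_onto_dist[OF m(1,3)] isometry_onto_dist[OF m(2,3)]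
      by simp
  qed (use st in auto)
  ultimately show "mdist N (c s) (c' t) \<le>
      dist ((1 - s) *\<^sub>R p' + s *\<^sub>R q') ((1 - t) *\<^sub>R p' + t *\<^sub>R r')"
    by (simp add: isometry_onto_dist)
qed

end

text \<open>A closed convex set containing the copy of \<open>A\<close> contains the copy of the
  rational hull by induction; that copy is dense in \<open>N\<close>, so closedness gives
  everything.\<close>

lemma closed_bicombing_hull_isometry_onto:
  assumes con: "conical_bicombing M \<sigma>" and A: "A \<subseteq> mspace M"
    and iso: "isometry_onto N M g (mtopology_of M closure_of rational_hull \<sigma> A)"
  defines "h \<equiv> inv_into (mspace N) g"
  shows "closed_bicombing_hull N (\<lambda>x y t. h (\<sigma> (g x) (g y) t)) (h ` A) = mspace N"
proof -
  let ?D = "rational_hull \<sigma> A" and ?\<sigma> = "\<lambda>x y t. h (\<sigma> (g x) (g y) t)"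
  let ?H = "mtopology_of M closure_of rational_hull \<sigma> A"
  have D: "?D \<subseteq> mspace M"
    by (rule rational_hull_subset_mspace[OF con A])
  have DH: "?D \<subseteq> ?H"
    using D by (simp add: closure_of_subset)
  have AH: "A \<subseteq> ?H"
    by (rule closure_rational_hull_superset[OF con A])
  note h = isometry_onto_inv[OF iso, folded h_def]
  have conv: "bicombing_convex M \<sigma> ?H"
    by (rule bicombing_convex_closure_rational_hull[OF con A])
  have conN: "conical_bicombing N ?\<sigma>"
    unfolding h_def by (rule isometry_onto_conical_bicombing[OF iso con conv])
  have "mspace N \<subseteq> C"
    if C: "closedin (mtopology_of N) C" "bicombing_convex N ?\<sigma> C" "h ` A \<subseteq> C" for C
  proof
    have hD: "h d \<in> C" if "d \<in> ?D" for d
      using that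
    proof induction
      case (base a)
      then show ?case using C(3) by blast
    next
      case (step x y q)
      then have "?\<sigma> (h x) (h y) q \<in> C"
        using C(2) by (auto simp: bicombing_convex_def image_subset_iff)
      then show ?case
        using step.hyps DH h(2) by (simp add: subset_iff)
    qed
    fix x assume x: "x \<in> mspace N"
    have "\<exists>z\<in>C. mdist N x z < e" if "e > 0" for e
    proof -
      have "g x \<in> ?H" using isometry_onto_mem(1)[OF iso x] .
      then obtain d where d: "d \<in> ?D" "mdist M (g x) d < e"
        using \<open>e > 0\<close> unfolding in_closure_mtopology_of_iff[OF D] by blast
      then have "mdist N x (h d) < e"
        using DH h[of d] isometry_onto_dist[OF iso x, of "h d"] by auto
      then show ?thesis using hD d(1) by blast
    qed
    then show "x \<in> C"
      using C(1) x unfolding closedin_mtopology_of_iff by blast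
  qed
  moreover have "closedin (mtopology_of N) (mspace N)"
    by (simp add: closedin_mtopology_of_iff)
  moreover have "bicombing_convex N ?\<sigma> (mspace N)"
    by (rule bicombing_convex_mspace[OF conN])
  moreover have "h ` A \<subseteq> mspace N"
    using AH h(1) by blast
  ultimately show ?thesis
    unfolding closed_bicombing_hull_def by blast
qed

section \<open>CAT(0) spaces\<close>

text \<open>The vertices are (0,0), (a,0) and (u,v), where the law of cosines determines
  \<open>u\<close>; the triangle inequalities say exactly that \<bar>u\<bar> \<le> b, so that
  \<open>v\<close> exists. A vanishing side \<open>a\<close> is separate because of the
  division.\<close>

lemma comparison_triangle_exists:
  fixes a b c :: real
  assumes nonneg: "0 \<le> a" "0 \<le> b" "0 \<le> c" and tri: "a \<le> b + c" "b \<le> a + c" "c \<le> a + b"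
  shows "\<exists>p q r :: real^2. dist p q = a \<and> dist p r = b \<and> dist q r = c"
proof -
  have dist_vector: "dist (vector [x, y] :: real^2) (vector [x', y']) = sqrt ((x - x')\<^sup>2 + (y - y')\<^sup>2)"
    for x y x' y' :: real
    by (simp add: dist_vec_def L2_set_def sum_2 dist_real_def)
  show ?thesis
  proof (cases "a = 0")
    case True
    then have "b = c" using tri by simp
    show ?thesis
      by (rule exI[of _ "vector [0, 0]"], rule exI[of _ "vector [0, 0]"], rule exI[of _ "vector [b, 0]"])
        (use True \<open>b = c\<close> nonneg in \<open>simp add: dist_vector\<close>)
  next
    case False
    define u where "u = (a\<^sup>2 + b\<^sup>2 - c\<^sup>2) / (2 * a)"
    have u: "2 * a * u = a\<^sup>2 + b\<^sup>2 - c\<^sup>2"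
      using False by (simp add: u_def)
    have "c\<^sup>2 \<le> (a + b)\<^sup>2"
      using nonneg tri by (intro power_mono) auto
    then have "a * - b \<le> a * u"
      using u by (simp add: power2_eq_square algebra_simps)
    then have 1: "- b \<le> u"
      using False nonneg by (subst (asm) mult_le_cancel_left_pos) auto
    have "(a - b)\<^sup>2 \<le> c\<^sup>2"
      using nonneg tri by (intro abs_le_square_iff[THEN iffD1]) auto
    then have "a * u \<le> a * b"
      using u by (simp add: power2_eq_square algebra_simps)
    then have 2: "u \<le> b"
      using False nonneg by (subst (asm) mult_le_cancel_left_pos) auto
    have "u\<^sup>2 \<le> b\<^sup>2"
      using 1 2 nonneg by (intro abs_le_square_iff[THEN iffD1]) auto
    then have v: "(sqrt (b\<^sup>2 - u\<^sup>2))\<^sup>2 = b\<^sup>2 - u\<^sup>2"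
      by simp
    have "(a - u)\<^sup>2 + (b\<^sup>2 - u\<^sup>2) = c\<^sup>2"
      using u by (simp add: power2_eq_square algebra_simps)
    then show ?thesis
      using nonneg v
      by (intro exI[of _ "vector [0, 0]"] exI[of _ "vector [a, 0]"] exI[of _ "vector [u, sqrt (b\<^sup>2 - u\<^sup>2)]"])
        (simp add: dist_vector)
  qed
qed

section \<open>Uniqueness of geodesics and the bicombing of a CAT(0) space\<close>

lemma geodesic_from_to_mem:
  assumes "geodesic_from_to Y x y c"
  shows "t \<in> {0..1} \<Longrightarrow> c t \<in> mspace Y" "x \<in> mspace Y" "y \<in> mspace Y"
proof -
  have *: "c t \<in> mspace Y" if "t \<in> {0..1}" for t
    using assms that by (auto simp: geodesic_from_to_def geodesic_path_def)
  show "t \<in> {0..1} \<Longrightarrow> c t \<in> mspace Y" by (rule *)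
  show "x \<in> mspace Y" "y \<in> mspace Y"
    using *[of 0] *[of 1] assms by (auto simp: geodesic_from_to_def)
qed

lemma geodesic_from_to_dist:
  assumes "geodesic_from_to Y x y c" "s \<in> {0..1}" "t \<in> {0..1}"
  shows "mdist Y (c s) (c t) = \<bar>s - t\<bar> * mdist Y x y"
  using assms unfolding geodesic_from_to_def geodesic_path_def by metis

lemma geodesic_from_to_reverse:
  assumes c: "geodesic_from_to Y x y c"
  shows "geodesic_from_to Y y x (\<lambda>t. c (1 - t))"
proof (rule geodesic_from_toI)
  show "c (1 - t) \<in> mspace Y" if "t \<in> {0..1}" for t
    using geodesic_from_to_mem(1)[OF c] that by simp
  show "c (1 - 0) = y" "c (1 - 1) = x"
    using c by (simp_all add: geodesic_from_to_def)
  show "mdist Y (c (1 - s)) (c (1 - t)) \<le> (t - s) * mdist Y y x" if "0 \<le> s" "s \<le> t" "t \<le> 1" for s t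
    using geodesic_from_to_dist[OF c, of "1 - s" "1 - t"] that by (simp add: mdist_commute[of Y y x])
qed

text \<open>At equal parameters the comparison points differ by t (q' - r'). This is the conical
  inequality for geodesics with a common starting point.\<close>

lemma CAT0_space_dist_le:
  assumes cat: "CAT0_space Y" and c: "geodesic_from_to Y p q c" and c': "geodesic_from_to Y p r c'"
    and t: "t \<in> {0..1}"
  shows "mdist Y (c t) (c' t) \<le> t * mdist Y q r"
proof -
  have m: "p \<in> mspace Y" "q \<in> mspace Y" "r \<in> mspace Y"
    using geodesic_from_to_mem[OF c] geodesic_from_to_mem[OF c'] by auto
  have "mdist Y p q \<le> mdist Y p r + mdist Y q r"
    using mdist_triangle[OF m(1,3,2)] by (simp add: mdist_commute)
  moreover have "mdist Y p r \<le> mdist Y p q + mdist Y q r"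
    using mdist_triangle[OF m(1,2,3)] .
  moreover have "mdist Y q r \<le> mdist Y p q + mdist Y p r"
    using mdist_triangle[OF m(2,1,3)] by (simp add: mdist_commute)
  ultimately obtain p' q' r' :: "real^2"
    where d: "dist p' q' = mdist Y p q" "dist p' r' = mdist Y p r" "dist q' r' = mdist Y q r"
    using comparison_triangle_exists[of "mdist Y p q" "mdist Y p r" "mdist Y q r"] by auto
  have "mdist Y (c t) (c' t) \<le> dist ((1 - t) *\<^sub>R p' + t *\<^sub>R q') ((1 - t) *\<^sub>R p' + t *\<^sub>R r')"
    using cat[unfolded CAT0_space_def, THEN conjunct2, rule_format, OF m _ t t] c c' d by blast
  also have "\<dots> = t * dist q' r'"
    using t by (simp add: dist_norm scaleR_diff_right[symmetric])
  finally show ?thesis by (simp add: d)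
qed

text \<open>The two geodesics are sides of a degenerate triangle whose third side has length
  0.\<close>

lemma CAT0_space_geodesic_unique:
  assumes "CAT0_space Y" "geodesic_from_to Y x y c" "geodesic_from_to Y x y c'" "t \<in> {0..1}"
  shows "c t = c' t"
proof -
  note m = geodesic_from_to_mem[OF assms(2)] geodesic_from_to_mem[OF assms(3)]
  have "mdist Y (c t) (c' t) \<le> t * mdist Y y y"
    by (rule CAT0_space_dist_le[OF assms])
  moreover have "mdist Y y y = 0"
    using m by simp
  ultimately have "mdist Y (c t) (c' t) = 0"
    using mdist_nonneg[of Y "c t" "c' t"] by simp
  then show ?thesis
    using m assms(4) by simp
qed

lemma CAT0_space_conical_bicombing:
  assumes cat: "CAT0_space Y"
  shows "\<exists>\<sigma>. conical_bicombing Y \<sigma>"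
proof -
  have "\<forall>x y. \<exists>c. x \<in> mspace Y \<longrightarrow> y \<in> mspace Y \<longrightarrow> geodesic_from_to Y x y c"
    using cat unfolding CAT0_space_def by blast
  then obtain \<sigma> where \<sigma>: "geodesic_from_to Y x y (\<sigma> x y)" if "x \<in> mspace Y" "y \<in> mspace Y" for x y
    by metis
  have "mdist Y (\<sigma> x y t) (\<sigma> x' y' t) \<le> (1 - t) * mdist Y x x' + t * mdist Y y y'"
    if m: "x \<in> mspace Y" "y \<in> mspace Y" "x' \<in> mspace Y" "y' \<in> mspace Y" and t: "t \<in> {0..1}" for x y x' y' t
  proof -
    \<comment> \<open>compare both geodesics with the diagonal from \<open>x\<close> to \<open>y'\<close>\<close>
    have "mdist Y (\<sigma> x y t) (\<sigma> x' y' t) \<le> mdist Y (\<sigma> x y t) (\<sigma> x y' t) + mdist Y (\<sigma> x y' t) (\<sigma> x' y' t)"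
      using geodesic_from_to_mem(1)[OF \<sigma>] m t by (intro mdist_triangle) auto
    moreover have "mdist Y (\<sigma> x y t) (\<sigma> x y' t) \<le> t * mdist Y y y'"
      using CAT0_space_dist_le[OF cat \<sigma> \<sigma> t] m by blast
    \<comment> \<open>Reversal turns the common end point \<open>y'\<close> into a common starting
      point and the parameter \<open>t\<close> into 1 - t.\<close>
    moreover have "mdist Y (\<sigma> x y' (1 - (1 - t))) (\<sigma> x' y' (1 - (1 - t))) \<le> (1 - t) * mdist Y x x'"
      using m t
      by (intro CAT0_space_dist_le[OF cat geodesic_from_to_reverse[OF \<sigma>] geodesic_from_to_reverse[OF \<sigma>]]) auto
    ultimately show ?thesis by simp
  qed
  then have "conical_bicombing Y \<sigma>"
    using \<sigma> by (simp add: conical_bicombing_def bicombing_def)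
  then show ?thesis by blast
qed

lemma CAT0_space_bicombing_unique:
  assumes cat: "CAT0_space Y" and con: "conical_bicombing Y \<sigma>"
    and c: "geodesic_from_to Y x y c" and t: "t \<in> {0..1}"
  shows "c t = \<sigma> x y t"
  using CAT0_space_geodesic_unique[OF cat c _ t] conical_bicombing_geodesic[OF con] geodesic_from_to_mem[OF c]
  by blast

text \<open>By uniqueness every geodesic is a bicombing line, so convexity for the bicombing
  controls all geodesics.\<close>

lemma CAT0_space_geodesically_convex:
  assumes cat: "CAT0_space Y" and con: "conical_bicombing Y \<sigma>" and conv: "bicombing_convex Y \<sigma> C"
  shows "geodesically_convex Y C"
proof -
  have "c ` {0..1} \<subseteq> C" if "x \<in> C" "y \<in> C" "geodesic_from_to Y x y c" for x y c
  proof -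
    have "c ` {0..1} = \<sigma> x y ` {0..1}"
      using CAT0_space_bicombing_unique[OF cat con that(3)] by (intro image_cong) auto
    then show ?thesis
      using conv that unfolding bicombing_convex_def by simp
  qed
  then show ?thesis
    using conv unfolding bicombing_convex_def geodesically_convex_def by blast
qed

section \<open>Weighted supremum products\<close>

text \<open>The coordinate metrics are scaled down by the weights \<open>L\<close>, and only points at bounded
  distance from the base point \<open>b\<close> are kept, so that the suprema below are finite.\<close>

locale weighted_sup_product =
  fixes I :: "'i set" and M :: "'i \<Rightarrow> 'a metric" and L :: "'i \<Rightarrow> real" and b :: "'i \<Rightarrow> 'a"
  assumes nonempty: "I \<noteq> {}"
    and pos: "i \<in> I \<Longrightarrow> 0 < L i"
    and base: "i \<in> I \<Longrightarrow> b i \<in> mspace (M i)"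
begin

definition points :: "('i \<Rightarrow> 'a) set" where
  "points = {x \<in> \<Pi>\<^sub>E i\<in>I. mspace (M i). \<exists>K. \<forall>i\<in>I. mdist (M i) (x i) (b i) \<le> K * L i}"

text \<open>The value 0 off \<open>points\<close> makes nonnegativity and symmetry hold for all
  arguments, as \<open>Metric_space\<close> demands.\<close>

definition sup_dist :: "('i \<Rightarrow> 'a) \<Rightarrow> ('i \<Rightarrow> 'a) \<Rightarrow> real" where
  "sup_dist x y =
     (if x \<in> points \<and> y \<in> points then SUP i\<in>I. mdist (M i) (x i) (y i) / L i else 0)"

definition product :: "('i \<Rightarrow> 'a) metric" where
  "product = metric (points, sup_dist)"

lemma points_mem: "x \<in> points \<Longrightarrow> i \<in> I \<Longrightarrow> x i \<in> mspace (M i)"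
  by (auto simp: points_def)

text \<open>Distances to the base point bound the scaled coordinate distances uniformly, so the
  supremum is finite. The result says that the projection to coordinate \<open>i\<close> is
  Lipschitz with constant \<open>L i\<close>.\<close>

lemma coordinate_dist_le:
  assumes x: "x \<in> points" and y: "y \<in> points" and i: "i \<in> I"
  shows "mdist (M i) (x i) (y i) \<le> sup_dist x y * L i"
proof -
  obtain K K' where K: "\<And>i. i \<in> I \<Longrightarrow> mdist (M i) (x i) (b i) \<le> K * L i"
    and K': "\<And>i. i \<in> I \<Longrightarrow> mdist (M i) (y i) (b i) \<le> K' * L i"
    using x y unfolding points_def by blast
  have "mdist (M j) (x j) (y j) / L j \<le> K + K'" if j: "j \<in> I" for j
  proof -
    have "mdist (M j) (x j) (y j) \<le> mdist (M j) (x j) (b j) + mdist (M j) (b j) (y j)"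
      using points_mem[OF x j] points_mem[OF y j] base[OF j] by (intro mdist_triangle)
    also have "\<dots> \<le> (K + K') * L j"
      using K[OF j] K'[OF j] by (simp add: mdist_commute[of _ "b j"] distrib_right)
    finally show ?thesis
      using pos[OF j] by (simp add: divide_le_eq)
  qed
  then have "bdd_above ((\<lambda>i. mdist (M i) (x i) (y i) / L i) ` I)"
    by (rule bdd_aboveI2)
  then have "mdist (M i) (x i) (y i) / L i \<le> sup_dist x y"
    using cSUP_upper[OF i] x y unfolding sup_dist_def by simp
  then show ?thesis
    using pos[OF i] by (simp add: divide_le_eq)
qed

lemma sup_dist_le:
  assumes "x \<in> points" "y \<in> points" and "\<And>i. i \<in> I \<Longrightarrow> mdist (M i) (x i) (y i) \<le> K * L i"
  shows "sup_dist x y \<le> K"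
  using assms nonempty pos unfolding sup_dist_def
  by (auto intro!: cSUP_least simp: divide_le_eq)

lemma sup_dist_nonneg: "0 \<le> sup_dist x y"
proof (cases "x \<in> points \<and> y \<in> points")
  case True
  obtain i where i: "i \<in> I" using nonempty by blast
  have "0 \<le> mdist (M i) (x i) (y i)" by simp
  also have "\<dots> \<le> sup_dist x y * L i"
    using coordinate_dist_le True i by blast
  finally show ?thesis
    using pos[OF i] by (simp add: zero_le_mult_iff)
next
  case False
  then show ?thesis by (auto simp: sup_dist_def)
qed

lemma Metric_space_product: "Metric_space points sup_dist"
proof
  fix x y z
  show "0 \<le> sup_dist x y" by (rule sup_dist_nonneg)
  show "sup_dist x y = sup_dist y x"
    by (simp add: sup_dist_def mdist_commute conj_commute)
  show "sup_dist x y = 0 \<longleftrightarrow> x = y" if x: "x \<in> points" and y: "y \<in> points"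
  proof
    assume 0: "sup_dist x y = 0"
    have "x i = y i" if i: "i \<in> I" for i
    proof -
      have "mdist (M i) (x i) (y i) \<le> 0"
        using coordinate_dist_le[OF x y i] 0 by simp
      then have "mdist (M i) (x i) (y i) = 0"
        using mdist_nonneg by (intro antisym)
      then show ?thesis
        using points_mem x y i by simp
    qed
    moreover have "x \<in> extensional I" "y \<in> extensional I"
      using x y by (auto simp: points_def PiE_def)
    ultimately show "x = y" by (intro extensionalityI)
  next
    assume "x = y"
    moreover have "mdist (M i) (x i) (x i) = 0" if "i \<in> I" for i
      using points_mem[OF x that] by simp
    ultimately have "sup_dist x y \<le> 0"
      using x by (intro sup_dist_le) auto
    then show "sup_dist x y = 0"
      using sup_dist_nonneg by (intro antisym)
  qed
  show "sup_dist x z \<le> sup_dist x y + sup_dist y z"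
    if x: "x \<in> points" and y: "y \<in> points" and z: "z \<in> points"
  proof (rule sup_dist_le[OF x z])
    fix i assume i: "i \<in> I"
    have "mdist (M i) (x i) (z i) \<le> mdist (M i) (x i) (y i) + mdist (M i) (y i) (z i)"
      using points_mem x y z i by (intro mdist_triangle)
    also have "\<dots> \<le> (sup_dist x y + sup_dist y z) * L i"
      using coordinate_dist_le[OF x y i] coordinate_dist_le[OF y z i] by (simp add: distrib_right)
    finally show "mdist (M i) (x i) (z i) \<le> (sup_dist x y + sup_dist y z) * L i" .
  qed
qed

lemma mspace_product [simp]: "mspace product = points"
  by (simp add: product_def Metric_space.mspace_metric[OF Metric_space_product])

lemma mdist_product [simp]: "mdist product = sup_dist"
  by (simp add: product_def Metric_space.mdist_metric[OF Metric_space_product])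

text \<open>Limits are taken coordinatewise; the Cauchy estimate in the supremum metric makes the
  convergence uniform over the coordinates.\<close>

lemma mcomplete_product:
  assumes complete: "\<And>i. i \<in> I \<Longrightarrow> mcomplete_of (M i)"
  shows "mcomplete_of product"
  unfolding mcomplete_of_iff
proof (intro allI impI, elim conjE)
  fix s assume "range s \<subseteq> mspace product"
    and cauchy: "\<forall>e>0. \<exists>N::nat. \<forall>m n. N \<le> m \<longrightarrow> N \<le> n \<longrightarrow> mdist product (s m) (s n) < e"
  then have s: "s n \<in> points" for n by auto
  have "\<exists>l\<in>mspace (M i). \<forall>e>0. \<exists>N. \<forall>n\<ge>N. mdist (M i) (s n i) l < e" if i: "i \<in> I" for i
  proof (rule complete[OF i, unfolded mcomplete_of_iff, rule_format], intro conjI allI impI)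
    show "range (\<lambda>n. s n i) \<subseteq> mspace (M i)"
      using s points_mem i by blast
    fix e :: real assume "e > 0"
    then have "e / L i > 0" using pos[OF i] by simp
    then obtain N where N: "\<And>m n. N \<le> m \<Longrightarrow> N \<le> n \<Longrightarrow> sup_dist (s m) (s n) < e / L i"
      using cauchy by (metis mdist_product)
    have "mdist (M i) (s m i) (s n i) < e" if "N \<le> m" "N \<le> n" for m n
    proof -
      have "mdist (M i) (s m i) (s n i) \<le> sup_dist (s m) (s n) * L i"
        by (rule coordinate_dist_le[OF s s i])
      also have "\<dots> < e"
        using N[OF that] pos[OF i] by (simp add: less_divide_eq)
      finally show ?thesis .
    qed
    then show "\<exists>N. \<forall>m n. N \<le> m \<longrightarrow> N \<le> n \<longrightarrow> mdist (M i) (s m i) (s n i) < e"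
      by blast
  qed
  then obtain l where l: "\<And>i. i \<in> I \<Longrightarrow> l i \<in> mspace (M i)"
    and lim: "\<And>i e. i \<in> I \<Longrightarrow> e > 0 \<Longrightarrow> \<exists>N. \<forall>n\<ge>N. mdist (M i) (s n i) (l i) < e"
    by metis
  \<comment> \<open>The Cauchy bound passes to the limit in the second argument; \<open>N\<close>
    does not depend on \<open>i\<close>.\<close>
  have unif: "mdist (M i) (s m i) (l i) \<le> e * L i"
    if N: "\<And>m n. N \<le> m \<Longrightarrow> N \<le> n \<Longrightarrow> sup_dist (s m) (s n) < e" and i: "i \<in> I" and m: "N \<le> m"
    for e N i m
  proof (rule field_le_epsilon)
    fix \<delta> :: real assume "\<delta> > 0"
    then obtain K where K: "\<And>n. n \<ge> K \<Longrightarrow> mdist (M i) (s n i) (l i) < \<delta>"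
      using lim[OF i] by blast
    let ?n = "max N K"
    have "mdist (M i) (s m i) (l i) \<le> mdist (M i) (s m i) (s ?n i) + mdist (M i) (s ?n i) (l i)"
      using points_mem[OF s i] l[OF i] by (intro mdist_triangle)
    also have "mdist (M i) (s m i) (s ?n i) \<le> sup_dist (s m) (s ?n) * L i"
      by (rule coordinate_dist_le[OF s s i])
    also have "sup_dist (s m) (s ?n) * L i \<le> e * L i"
      using N[OF m, of ?n] pos[OF i] by (intro mult_right_mono) auto
    also have "mdist (M i) (s ?n i) (l i) \<le> \<delta>"
      using K[of ?n] by simp
    finally show "mdist (M i) (s m i) (l i) \<le> e * L i + \<delta>"
      by simp
  qed
  let ?l = "restrict l I"
  \<comment> \<open>The limit has finite distance from the base point because it is uniformly close
    to a single member \<open>s N\<close> of the sequence.\<close>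
  have "?l \<in> points"
  proof -
    obtain N where N: "\<And>m n. N \<le> m \<Longrightarrow> N \<le> n \<Longrightarrow> sup_dist (s m) (s n) < 1"
      using cauchy zero_less_one by (metis mdist_product)
    obtain K where K: "\<And>i. i \<in> I \<Longrightarrow> mdist (M i) (s N i) (b i) \<le> K * L i"
      using s[of N] unfolding points_def by blast
    have "mdist (M i) (?l i) (b i) \<le> (1 + K) * L i" if i: "i \<in> I" for i
    proof -
      have "mdist (M i) (l i) (b i) \<le> mdist (M i) (l i) (s N i) + mdist (M i) (s N i) (b i)"
        using points_mem[OF s i] l[OF i] base[OF i] by (intro mdist_triangle)
      moreover have "mdist (M i) (s N i) (l i) \<le> 1 * L i"
        by (rule unif[where N = N]) (use N i in auto)
      ultimately show ?thesis
        using K[OF i] i by (simp add: mdist_commute[of _ "l i"] distrib_right)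
    qed
    then show ?thesis
      using l unfolding points_def by auto
  qed
  moreover have "\<exists>N. \<forall>n\<ge>N. sup_dist (s n) ?l < e" if e: "e > 0" for e
  proof -
    have "e / 2 > 0" using e by simp
    then obtain N where N: "\<And>m n. N \<le> m \<Longrightarrow> N \<le> n \<Longrightarrow> sup_dist (s m) (s n) < e / 2"
      using cauchy by (metis mdist_product)
    have "sup_dist (s n) ?l \<le> e / 2" if "n \<ge> N" for n
    proof (rule sup_dist_le[OF s \<open>?l \<in> points\<close>])
      fix i assume i: "i \<in> I"
      have "mdist (M i) (s n i) (l i) \<le> e / 2 * L i"
        by (rule unif[where N = N]) (use N i that in auto)
      then show "mdist (M i) (s n i) (?l i) \<le> e / 2 * L i"
        using i by simp
    qed
    moreover have "e / 2 < e" using e by simp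
    ultimately have "\<forall>n\<ge>N. sup_dist (s n) ?l < e"
      by (meson le_less_trans)
    then show ?thesis ..
  qed
  ultimately show "\<exists>l\<in>mspace product. \<forall>e>0. \<exists>N. \<forall>n\<ge>N. mdist product (s n) l < e"
    unfolding mspace_product mdist_product by blast
qed

text \<open>Each required estimate holds in every coordinate with scaled bounds and therefore
  survives the supremum.\<close>

lemma conical_bicombing_product:
  assumes con: "\<And>i. i \<in> I \<Longrightarrow> conical_bicombing (M i) (\<sigma> i)"
  shows "conical_bicombing product (\<lambda>x y t. \<lambda>i\<in>I. \<sigma> i (x i) (y i) t)"
proof -
  let ?\<sigma> = "\<lambda>x y t. \<lambda>i\<in>I. \<sigma> i (x i) (y i) t"
  have mem: "?\<sigma> x y t \<in> points" if x: "x \<in> points" and y: "y \<in> points" and t: "t \<in> {0..1}" for x y t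
  proof -
    obtain K where K: "\<And>i. i \<in> I \<Longrightarrow> mdist (M i) (x i) (b i) \<le> K * L i"
      using x unfolding points_def by blast
    have m: "\<sigma> i (x i) (y i) t \<in> mspace (M i)" if i: "i \<in> I" for i
      using conical_bicombing_mem[OF con[OF i] points_mem[OF x i] points_mem[OF y i]] t by simp
    \<comment> \<open>Moving from \<open>x\<close> along the line costs at most the distance of
      \<open>x\<close> and \<open>y\<close>, so bounded distance from the base point is
      preserved.\<close>
    have "mdist (M i) (\<sigma> i (x i) (y i) t) (b i) \<le> (sup_dist x y + K) * L i" if i: "i \<in> I" for i
    proof -
      note mx = points_mem[OF x i] and my = points_mem[OF y i]
      have "mdist (M i) (\<sigma> i (x i) (y i) t) (b i)
          \<le> mdist (M i) (\<sigma> i (x i) (y i) t) (x i) + mdist (M i) (x i) (b i)"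
        using m[OF i] mx base[OF i] by (intro mdist_triangle)
      also have "mdist (M i) (\<sigma> i (x i) (y i) t) (x i) = t * mdist (M i) (x i) (y i)"
        using conical_bicombing_dist[OF con[OF i] mx my t, of 0] t
          conical_bicombing_ends(1)[OF con[OF i] mx my] by simp
      also have "t * mdist (M i) (x i) (y i) \<le> 1 * mdist (M i) (x i) (y i)"
        using t by (intro mult_right_mono) auto
      finally show ?thesis
        using coordinate_dist_le[OF x y i] K[OF i] by (simp add: distrib_right)
    qed
    then show ?thesis
      using m unfolding points_def by auto
  qed
  have geo: "geodesic_from_to product x y (?\<sigma> x y)" if x: "x \<in> points" and y: "y \<in> points" for x y
  proof (rule geodesic_from_toI)
    show "?\<sigma> x y t \<in> mspace product" if "t \<in> {0..1}" for t
      using mem[OF x y that] by simp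
    have "x \<in> extensional I" "y \<in> extensional I"
      using x y by (auto simp: points_def PiE_def)
    then show "?\<sigma> x y 0 = x" "?\<sigma> x y 1 = y"
      using conical_bicombing_ends[OF con] points_mem x y
      by (auto intro!: extensionalityI[of _ I])
    show "mdist product (?\<sigma> x y s) (?\<sigma> x y t) \<le> (t - s) * mdist product x y"
      if st: "0 \<le> s" "s \<le> t" "t \<le> 1" for s t
      unfolding mdist_product
    proof (rule sup_dist_le)
      fix i assume i: "i \<in> I"
      have "mdist (M i) (\<sigma> i (x i) (y i) s) (\<sigma> i (x i) (y i) t) = (t - s) * mdist (M i) (x i) (y i)"
        using conical_bicombing_dist[OF con[OF i] points_mem[OF x i] points_mem[OF y i], of s t] st by simp
      also have "\<dots> \<le> (t - s) * (sup_dist x y * L i)"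
        using st by (intro mult_left_mono coordinate_dist_le x y i) auto
      finally show "mdist (M i) (?\<sigma> x y s i) (?\<sigma> x y t i) \<le> (t - s) * sup_dist x y * L i"
        using i by (simp add: mult.assoc)
    qed (use mem x y st in auto)
  qed
  have "sup_dist (?\<sigma> x y t) (?\<sigma> x' y' t) \<le> (1 - t) * sup_dist x x' + t * sup_dist y y'"
    if x: "x \<in> points" and y: "y \<in> points" and x': "x' \<in> points" and y': "y' \<in> points" and t: "t \<in> {0..1}"
    for x y x' y' t
  proof (rule sup_dist_le[OF mem[OF x y t] mem[OF x' y' t]])
    fix i assume i: "i \<in> I"
    have "mdist (M i) (\<sigma> i (x i) (y i) t) (\<sigma> i (x' i) (y' i) t)
        \<le> (1 - t) * mdist (M i) (x i) (x' i) + t * mdist (M i) (y i) (y' i)"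
      by (intro conical_bicombing_le[OF con[OF i]] points_mem x y x' y' i t)
    also have "\<dots> \<le> (1 - t) * (sup_dist x x' * L i) + t * (sup_dist y y' * L i)"
      using t by (intro add_mono mult_left_mono coordinate_dist_le x y x' y' i) auto
    finally show "mdist (M i) (?\<sigma> x y t i) (?\<sigma> x' y' t i)
        \<le> ((1 - t) * sup_dist x x' + t * sup_dist y y') * L i"
      using i by (simp add: distrib_right mult.assoc)
  qed
  then show ?thesis
    using geo by (simp add: conical_bicombing_def bicombing_def)
qed

end

section \<open>The universal hull\<close>

text \<open>Needed for the real line, which serves as one coordinate of the universal
  product.\<close>

lemma conical_bicombing_euclidean:
  "conical_bicombing (euclidean_metric :: 'a::real_normed_vector metric) (\<lambda>x y t. (1 - t) *\<^sub>R x + t *\<^sub>R y)"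
proof -
  have "geodesic_from_to euclidean_metric x y (\<lambda>t. (1 - t) *\<^sub>R x + t *\<^sub>R y)" for x y :: 'a
  proof (rule geodesic_from_toI)
    fix s t :: real assume "0 \<le> s" "s \<le> t" "t \<le> 1"
    have "(1 - s) *\<^sub>R x + s *\<^sub>R y - ((1 - t) *\<^sub>R x + t *\<^sub>R y) = (t - s) *\<^sub>R (x - y)"
      by (simp add: algebra_simps)
    then show "mdist euclidean_metric ((1 - s) *\<^sub>R x + s *\<^sub>R y) ((1 - t) *\<^sub>R x + t *\<^sub>R y)
        \<le> (t - s) * mdist euclidean_metric x y"
      using \<open>s \<le> t\<close> by (simp add: dist_norm)
  qed auto
  moreover have "dist ((1 - t) *\<^sub>R x + t *\<^sub>R y) ((1 - t) *\<^sub>R x' + t *\<^sub>R y') \<le> (1 - t) * dist x x' + t * dist y y'"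
    if "t \<in> {0..1}" for x y x' y' :: 'a and t
  proof -
    have "dist ((1 - t) *\<^sub>R x + t *\<^sub>R y) ((1 - t) *\<^sub>R x' + t *\<^sub>R y')
        \<le> dist ((1 - t) *\<^sub>R x) ((1 - t) *\<^sub>R x') + dist (t *\<^sub>R y) (t *\<^sub>R y')"
      by (rule dist_triangle_add)
    moreover have "dist (r *\<^sub>R a) (r *\<^sub>R b) = \<bar>r\<bar> * dist a b" for r and a b :: 'a
      by (simp add: dist_norm flip: scaleR_diff_right)
    ultimately show ?thesis using that by simp
  qed
  ultimately show ?thesis
    by (simp add: conical_bicombing_def bicombing_def)
qed

text \<open>The rational hull of a countable set is countable and dense in its closure, so the
  points of the closure can be renamed by reals.\<close>

lemma closure_rational_hull_real_copy:
  fixes M :: "'a metric"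
  assumes con: "conical_bicombing M \<sigma>" and A: "A \<subseteq> mspace M" "countable A"
  shows "\<exists>(N :: real metric) g. isometry_onto N M g (mtopology_of M closure_of rational_hull \<sigma> A)"
proof -
  have "rational_hull \<sigma> A \<subseteq> mspace M"
    by (rule rational_hull_subset_mspace[OF con A(1)])
  then obtain f :: "'a \<Rightarrow> real" where "inj_on f (mtopology_of M closure_of rational_hull \<sigma> A)"
    using separable_inj_real[OF countable_rational_hull[OF A(2)]] by blast
  then show ?thesis
    using isometry_onto_exists closure_of_subset_topspace topspace_mtopology_of by metis
qed

text \<open>Only the closed hull \<open>H\<close> of \<open>A\<close> in \<open>Y\<close> matters.
  It is a complete CAT(0) space with a copy \<open>Z\<close> on reals; a map into \<open>Z\<close>
  is composed with the isometry onto \<open>H\<close>, and convexity of \<open>H\<close> lets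
  convexity of the image carry over from \<open>Z\<close> to \<open>Y\<close>.\<close>

lemma dominates_n_point_sets_real_imp:
  fixes X :: "'c metric"
  assumes dom: "dominates_n_point_sets n X TYPE(real)"
  shows "dominates_n_point_sets n X TYPE('b)"
  unfolding dominates_n_point_sets_def
proof (intro allI impI, elim conjE)
  fix Y :: "'b metric" and A
  assume complete: "mcomplete_of Y" and cat: "CAT0_space Y"
    and A: "A \<subseteq> mspace Y" "finite A" "card A = n"
  obtain \<sigma> where con: "conical_bicombing Y \<sigma>"
    using CAT0_space_conical_bicombing[OF cat] by blast
  define H where "H = mtopology_of Y closure_of rational_hull \<sigma> A"
  have conv: "bicombing_convex Y \<sigma> H"
    unfolding H_def by (rule bicombing_convex_closure_rational_hull[OF con A(1)])
  have gconv: "geodesically_convex Y H"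
    by (rule CAT0_space_geodesically_convex[OF cat con conv])
  obtain Z :: "real metric" and g where iso: "isometry_onto Z Y g H"
    using closure_rational_hull_real_copy[OF con A(1)] A(2) unfolding H_def by (meson countable_finite)
  define h where "h = inv_into (mspace Z) g"
  note h = isometry_onto_inv[OF iso, folded h_def]
  have AH: "A \<subseteq> H"
    unfolding H_def by (rule closure_rational_hull_superset[OF con A(1)])
  have "mcomplete_of Z"
    using isometry_onto_mcomplete[OF iso complete] by (simp add: H_def)
  moreover have "CAT0_space Z"
    by (rule isometry_onto_CAT0[OF iso cat gconv])
  moreover have "h ` A \<subseteq> mspace Z"
    using AH h(1) by blast
  moreover have "inj_on h A"
    using AH h(2) by (intro inj_on_inverseI[where g = g]) blast
  then have "card (h ` A) = n"
    using A(3) by (simp add: card_image)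
  ultimately obtain \<Phi> where \<Phi>: "Lipschitz_continuous_map X Z \<Phi>"
      "geodesically_convex Z (\<Phi> ` mspace X)" "h ` A \<subseteq> \<Phi> ` mspace X"
    using dom[unfolded dominates_n_point_sets_def, rule_format, of Z "h ` A"] A(2) by blast
  have \<Phi>Z: "\<Phi> x \<in> mspace Z" if "x \<in> mspace X" for x
    using \<Phi>(1) that by (auto simp: Lipschitz_continuous_map_def)
  let ?\<Psi> = "\<lambda>x. g (\<Phi> x)"
  have "Lipschitz_continuous_map X Y ?\<Psi>"
  proof -
    obtain B where B: "\<And>x y. x \<in> mspace X \<Longrightarrow> y \<in> mspace X \<Longrightarrow> mdist Z (\<Phi> x) (\<Phi> y) \<le> B * mdist X x y"
      using \<Phi>(1) unfolding Lipschitz_continuous_map_def by blast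
    have "mdist Y (?\<Psi> x) (?\<Psi> y) \<le> B * mdist X x y" if "x \<in> mspace X" "y \<in> mspace X" for x y
      using B[OF that] isometry_onto_dist[OF iso \<Phi>Z \<Phi>Z, OF that] by simp
    moreover have "?\<Psi> \<in> mspace X \<rightarrow> mspace Y"
      using isometry_onto_mem(2)[OF iso] \<Phi>Z by blast
    ultimately show ?thesis
      unfolding Lipschitz_continuous_map_def by blast
  qed
  moreover have "geodesically_convex Y (?\<Psi> ` mspace X)"
    unfolding geodesically_convex_def
  proof (intro conjI ballI allI impI)
    show "?\<Psi> ` mspace X \<subseteq> mspace Y"
      using isometry_onto_mem(2)[OF iso] \<Phi>Z by blast
    fix u v c
    assume "u \<in> ?\<Psi> ` mspace X" "v \<in> ?\<Psi> ` mspace X" and c: "geodesic_from_to Y u v c"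
    then obtain x y where x: "x \<in> mspace X" "u = g (\<Phi> x)" and y: "y \<in> mspace X" "v = g (\<Phi> y)"
      by blast
    \<comment> \<open>The geodesic of \<open>Y\<close> stays in \<open>H\<close>, so it can be read
      as a geodesic of \<open>Z\<close>.\<close>
    have cH: "c ` {0..1} \<subseteq> H"
      using gconv c isometry_onto_mem(1)[OF iso] \<Phi>Z x y unfolding geodesically_convex_def by blast
    have "geodesic_from_to Z (\<Phi> x) (\<Phi> y) (\<lambda>t. h (c t))"
      unfolding h_def using c x y \<Phi>Z cH by (intro isometry_onto_geodesic_inv[OF iso]) auto
    then have hc: "(\<lambda>t. h (c t)) ` {0..1} \<subseteq> \<Phi> ` mspace X"
      using \<Phi>(2) x(1) y(1) unfolding geodesically_convex_def by blast
    show "c ` {0..1} \<subseteq> ?\<Psi> ` mspace X"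
    proof
      fix z assume "z \<in> c ` {0..1}"
      then have "z \<in> H" "h z \<in> \<Phi> ` mspace X" using cH hc by auto
      then show "z \<in> ?\<Psi> ` mspace X"
        using h(2) by force
    qed
  qed
  moreover have "A \<subseteq> ?\<Psi> ` mspace X"
  proof
    fix a assume "a \<in> A"
    then have "h a \<in> \<Phi> ` mspace X" "g (h a) = a"
      using \<Phi>(3) AH h(2) by auto
    then show "a \<in> ?\<Psi> ` mspace X" by force
  qed
  ultimately show "\<exists>\<Phi>. Lipschitz_continuous_map X Y \<Phi> \<and> geodesically_convex Y (\<Phi> ` mspace X) \<and> A \<subseteq> \<Phi> ` mspace X"
    by blast
qed

text \<open>The index type of the universal product: complete spaces \<open>Y\<close> with a conical bicombing
  \<open>\<sigma>\<close>, points \<open>a 0, \<dots>, a (n - 1)\<close> of \<open>Y\<close> and an upper bound \<open>L\<close> for their distances. The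
  bound rescales \<open>Y\<close>, so that the marked points stay at distance at most 1.\<close>

type_synonym marked_space =
  "real metric \<times> (real \<Rightarrow> real \<Rightarrow> real \<Rightarrow> real) \<times> (nat \<Rightarrow> real) \<times> real"

text \<open>All data of a marked space have fixed types, so the marked spaces form a set
  \<open>I\<close> that can index a product. \<open>X\<close> is a copy on reals of the closed hull
  of the \<open>n\<close> diagonal points, and the maps to CAT(0) spaces are coordinate
  projections.\<close>

lemma universal_n_point_hull_exists:
  assumes "n \<ge> 1"
  shows "\<exists>X :: real metric. mcomplete_of X \<and> hull_of_n_points n X \<and> dominates_n_point_sets n X TYPE(real)"
proof -
  define I :: "marked_space set" where
    "I = {(Y, \<sigma>, a, L). mcomplete_of Y \<and> conical_bicombing Y \<sigma> \<and> (\<forall>k<n. a k \<in> mspace Y) \<and>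
      0 < L \<and> (\<forall>k<n. \<forall>l<n. mdist Y (a k) (a l) \<le> L)}"
  define M :: "marked_space \<Rightarrow> real metric" where "M = (\<lambda>(Y, \<sigma>, a, L). Y)"
  define S :: "marked_space \<Rightarrow> real \<Rightarrow> real \<Rightarrow> real \<Rightarrow> real" where "S = (\<lambda>(Y, \<sigma>, a, L). \<sigma>)"
  define P :: "marked_space \<Rightarrow> nat \<Rightarrow> real" where "P = (\<lambda>(Y, \<sigma>, a, L). a)"
  define W :: "marked_space \<Rightarrow> real" where "W = (\<lambda>(Y, \<sigma>, a, L). L)"
  have I: "mcomplete_of (M i)" "conical_bicombing (M i) (S i)" "0 < W i"
      "k < n \<Longrightarrow> P i k \<in> mspace (M i)"
      "k < n \<Longrightarrow> l < n \<Longrightarrow> mdist (M i) (P i k) (P i l) \<le> W i" if "i \<in> I" for i k l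
    using that by (cases i; simp add: I_def M_def S_def P_def W_def)+
  \<comment> \<open>The real line is one of the coordinates; it keeps the \<open>n\<close> marked points distinct.\<close>
  define line where "line = (euclidean_metric :: real metric,
    (\<lambda>x y t. (1 - t) *\<^sub>R x + t *\<^sub>R y) :: real \<Rightarrow> real \<Rightarrow> real \<Rightarrow> real, real, real n)"
  have "mcomplete_of (euclidean_metric :: real metric)"
    unfolding euclidean_metric_def Met_TC.mcomplete_of by (simp add: complete_UNIV)
  then have line: "line \<in> I"
    using assms conical_bicombing_euclidean[where ?'a = real]
    by (auto simp: line_def I_def dist_real_def)
  \<comment> \<open>The base point consists of the marked points with index 0, present because n
    \<ge> 1.\<close>
  interpret weighted_sup_product I M W "\<lambda>i. P i 0"
    using line I assms by unfold_locales auto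
  define \<sigma> where "\<sigma> = (\<lambda>x y t. \<lambda>i\<in>I. S i (x i) (y i) t)"
  have con: "conical_bicombing product \<sigma>"
    unfolding \<sigma>_def by (rule conical_bicombing_product[OF I(2)])
  define p where "p k = (\<lambda>i\<in>I. P i k)" for k
  define A where "A = p ` {..<n}"
  have "p k \<in> points" if "k < n" for k
  proof -
    have "mdist (M i) (p k i) (P i 0) \<le> 1 * W i" if "i \<in> I" for i
      using I(5)[OF that \<open>k < n\<close>, of 0] that assms by (simp add: p_def)
    moreover have "p k \<in> (\<Pi>\<^sub>E i\<in>I. mspace (M i))"
      using I(4) \<open>k < n\<close> by (auto simp: p_def)
    ultimately show ?thesis
      unfolding points_def by blast
  qed
  then have A: "A \<subseteq> mspace product" "finite A"
    by (auto simp: A_def)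
  have "p k line = real k" for k
    using line by (simp add: p_def P_def line_def)
  then have "inj p"
    by (metis injI of_nat_eq_iff)
  then have card: "card A = n"
    unfolding A_def by (simp add: card_image inj_on_subset)
  define H where "H = mtopology_of product closure_of rational_hull \<sigma> A"
  obtain X :: "real metric" and g where iso: "isometry_onto X product g H"
    using closure_rational_hull_real_copy[OF con A(1)] A(2) unfolding H_def by (meson countable_finite)
  define h where "h = inv_into (mspace X) g"
  note h = isometry_onto_inv[OF iso, folded h_def]
  define \<tau> where "\<tau> = (\<lambda>x y t. h (\<sigma> (g x) (g y) t))"
  have AH: "A \<subseteq> H"
    unfolding H_def by (rule closure_rational_hull_superset[OF con A(1)])
  have conv: "bicombing_convex product \<sigma> H"
    unfolding H_def by (rule bicombing_convex_closure_rational_hull[OF con A(1)])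
  have con_X: "conical_bicombing X \<tau>"
    unfolding \<tau>_def h_def by (rule isometry_onto_conical_bicombing[OF iso con conv])
  have g_points: "g x \<in> points" if "x \<in> mspace X" for x
    using isometry_onto_mem(2)[OF iso that] by simp
  have "mcomplete_of product"
    by (rule mcomplete_product[OF I(1)])
  then have "mcomplete_of X"
    using isometry_onto_mcomplete[OF iso] by (simp add: H_def)
  moreover have "hull_of_n_points n X"
    unfolding hull_of_n_points_def
  proof (intro exI conjI)
    show "conical_bicombing X \<tau>" by (rule con_X)
    show "h ` A \<subseteq> mspace X" using AH h(1) by blast
    show "finite (h ` A)" using A(2) by simp
    have "inj_on h A"
      using AH h(2) by (intro inj_on_inverseI[where g = g]) blast
    then show "card (h ` A) = n"
      using card by (simp add: card_image)
    show "mspace X = closed_bicombing_hull X \<tau> (h ` A)"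
      using closed_bicombing_hull_isometry_onto[OF con A(1) iso[unfolded H_def]] by (simp add: \<tau>_def h_def)
  qed
  moreover have "dominates_n_point_sets n X TYPE(real)"
    unfolding dominates_n_point_sets_def
  proof (intro allI impI, elim conjE)
    fix Y :: "real metric" and B
    assume Y: "mcomplete_of Y" and cat: "CAT0_space Y" and B: "B \<subseteq> mspace Y" "finite B" "card B = n"
    obtain \<rho> where \<rho>: "conical_bicombing Y \<rho>"
      using CAT0_space_conical_bicombing[OF cat] by blast
    obtain a where "bij_betw a {..<n} B"
      using ex_bij_betw_nat_finite[OF B(2)] B(3) by (auto simp: atLeast0LessThan)
    then have a: "a ` {..<n} = B" by (rule bij_betw_imp_surj_on)
    \<comment> \<open>The sum dominates every single distance; the summand 1 keeps \<open>L\<close>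
      positive when all distances vanish, as for n = 1.\<close>
    define L where "L = 1 + (\<Sum>(k, l)\<in>{..<n} \<times> {..<n}. mdist Y (a k) (a l))"
    have "mdist Y (a k) (a l) \<le> (\<Sum>(k, l)\<in>{..<n} \<times> {..<n}. mdist Y (a k) (a l))" if "k < n" "l < n" for k l
      using member_le_sum[of "(k, l)" "{..<n} \<times> {..<n}" "\<lambda>(k, l). mdist Y (a k) (a l)"] that by auto
    moreover have "0 \<le> (\<Sum>(k, l)\<in>{..<n} \<times> {..<n}. mdist Y (a k) (a l))"
      by (intro sum_nonneg) auto
    ultimately have L: "0 < L" "k < n \<Longrightarrow> l < n \<Longrightarrow> mdist Y (a k) (a l) \<le> L" for k l
      unfolding L_def by (auto intro: add_increasing)
    \<comment> \<open>The given space, with its bicombing and the enumerated points, is itself an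
      index of the product.\<close>
    define i where "i = (Y, \<rho>, a, L)"
    have i: "i \<in> I"
      using Y \<rho> a B(1) L by (auto simp: i_def I_def)
    have proj: "M i = Y" "S i = \<rho>" "P i = a" "W i = L"
      by (simp_all add: i_def M_def S_def P_def W_def)
    let ?\<Phi> = "\<lambda>x. g x i"
    have \<Phi>Y: "?\<Phi> x \<in> mspace Y" if "x \<in> mspace X" for x
      using points_mem[OF g_points[OF that] i] by (simp add: proj)
    have "mdist Y (?\<Phi> x) (?\<Phi> y) \<le> L * mdist X x y" if "x \<in> mspace X" "y \<in> mspace X" for x y
      using coordinate_dist_le[OF g_points g_points i, OF that] isometry_onto_dist[OF iso that]
      by (simp add: proj mult.commute)
    then have "Lipschitz_continuous_map X Y ?\<Phi>"
      unfolding Lipschitz_continuous_map_def using \<Phi>Y by blast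
    moreover have "geodesically_convex Y (?\<Phi> ` mspace X)"
      unfolding geodesically_convex_def
    proof (intro conjI ballI allI impI)
      show "?\<Phi> ` mspace X \<subseteq> mspace Y" using \<Phi>Y by blast
      fix u v c
      assume "u \<in> ?\<Phi> ` mspace X" "v \<in> ?\<Phi> ` mspace X" and c: "geodesic_from_to Y u v c"
      then obtain x y where x: "x \<in> mspace X" "u = g x i" and y: "y \<in> mspace X" "v = g y i"
        by blast
      have "c t \<in> ?\<Phi> ` mspace X" if t: "t \<in> {0..1}" for t
      proof -
        have "\<sigma> (g x) (g y) t \<in> H"
          using conv isometry_onto_mem(1)[OF iso] x(1) y(1) t unfolding bicombing_convex_def by blast
        then have "g (\<tau> x y t) = \<sigma> (g x) (g y) t" "\<tau> x y t \<in> mspace X"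
          using h by (auto simp: \<tau>_def)
        \<comment> \<open>Coordinate \<open>i\<close> of a bicombing line is a line of
          \<open>\<rho>\<close>, and by uniqueness every geodesic \<open>c\<close> of
          \<open>Y\<close> with these ends arises in this way.\<close>
        moreover have "c t = \<sigma> (g x) (g y) t i"
          using CAT0_space_bicombing_unique[OF cat \<rho> c t] x(2) y(2) i by (simp add: \<sigma>_def proj)
        ultimately show ?thesis by force
      qed
      then show "c ` {0..1} \<subseteq> ?\<Phi> ` mspace X" by blast
    qed
    moreover have "B \<subseteq> ?\<Phi> ` mspace X"
    proof
      fix z assume "z \<in> B"
      then obtain k where k: "k < n" "z = a k" using a by auto
      then have "p k \<in> H" using AH by (auto simp: A_def)
      then have "h (p k) \<in> mspace X" "g (h (p k)) i = z"
        using h i k by (auto simp: p_def proj)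
      then show "z \<in> ?\<Phi> ` mspace X" by force
    qed
    ultimately show "\<exists>\<Phi>. Lipschitz_continuous_map X Y \<Phi> \<and>
        geodesically_convex Y (\<Phi> ` mspace X) \<and> B \<subseteq> \<Phi> ` mspace X"
      by blast
  qed
  ultimately show ?thesis by blast
qed

text \<open>The second conjunct does not depend on how \<open>X\<close> was constructed: domination
  over carriers in the reals passes to every carrier type for any metric space.\<close>

theorem theorem1p3:
  fixes n :: nat
  assumes "n \<ge> 1"
  shows "(\<exists>X :: real metric.
            mcomplete_of X \<and> hull_of_n_points n X \<and> dominates_n_point_sets n X TYPE(real)) \<and>
         (\<forall>X :: real metric.
            mcomplete_of X \<and> hull_of_n_points n X \<and> dominates_n_point_sets n X TYPE(real) \<longrightarrow>
            dominates_n_point_sets n X TYPE('b))"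
  using universal_n_point_hull_exists[OF assms] dominates_n_point_sets_real_imp by blast

end
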